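(* Let $\mathcal{G}$ be a connected graph and let $\mathcal{F}$ be a subgraph of $\mathcal{G}$ that is a spanning forest. Then there exists a subgraph $\mathcal{T}$ of $\mathcal{G}$ that is a spanning tree of $\mathcal{G}$ and such that $\mathcal{F}$ is a subgraph of $\mathcal{T}$.
   Context: Graphs are finite and undirected (they model the nodes and branches of an electrical distribution network). A subgraph of a graph consists of a subset of the vertices and edges of the graph. A spanning forest is a graph with no cycles. A spanning tree of $\mathcal{G}$ is a subgraph of $\mathcal{G}$ that connects all the vertices of $\mathcal{G}$ and contains no cycles. *)

theory Defs
  imports Main
begin

text \<open>
  Undirected graphs, possibly with parallel edges and loops: every edge is mapped to its unordered
  set of endpoints, which is a singleton precisely for a loop. A simple graph with a set of
  two-element sets as edges is the instance where \<open>ends\<close> is the identity.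

  In contrast to modelling undirected graphs as symmetric digraphs, traversing an edge back and forth is not a cycle.
\<close>

record ('v, 'e) ugraph =
  verts :: "'v set"
  edges :: "'e set"
  ends :: "'e \<Rightarrow> 'v set"

definition finite_graph :: "('v, 'e) ugraph \<Rightarrow> bool" where
  "finite_graph G \<longleftrightarrow> finite (verts G) \<and> finite (edges G) \<and>
     (\<forall>e \<in> edges G. \<exists>u \<in> verts G. \<exists>v \<in> verts G. ends G e = {u, v})"

text \<open>
  Values of \<open>ends\<close> outside the edge set carry no meaning, so a subgraph need only agree
  with the larger graph on its own edges.
\<close>

definition subgraph :: "('v, 'e) ugraph \<Rightarrow> ('v, 'e) ugraph \<Rightarrow> bool" where
  "subgraph H G \<longleftrightarrow> finite_graph H \<and> finite_graph G \<and>
     verts H \<subseteq> verts G \<and> edges H \<subseteq> edges G \<and> (\<forall>e \<in> edges H. ends H e = ends G e)"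

text \<open>
  A walk is given by its start vertex, the list of its steps and its final vertex, where a step
  consists of the edge traversed and the vertex reached.
\<close>

fun walk :: "('v, 'e) ugraph \<Rightarrow> 'v \<Rightarrow> ('e \<times> 'v) list \<Rightarrow> 'v \<Rightarrow> bool" where
  "walk G u [] v \<longleftrightarrow> u \<in> verts G \<and> u = v"
| "walk G u ((e, w) # p) v \<longleftrightarrow>
     u \<in> verts G \<and> e \<in> edges G \<and> ends G e = {u, w} \<and> walk G w p v"

text \<open>
  The start vertex of a closed walk is also the last vertex reached, so the second distinctness
  condition covers all vertices of the cycle. Distinctness of the edges only matters for length 2:
  two parallel edges form a cycle, a single edge used twice does not. A loop is a cycle of length 1.
\<close>

definition cycle :: "('v, 'e) ugraph \<Rightarrow> 'v \<Rightarrow> ('e \<times> 'v) list \<Rightarrow> bool" where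
  "cycle G u p \<longleftrightarrow>
     walk G u p u \<and> p \<noteq> [] \<and> distinct (map fst p) \<and> distinct (map snd p)"

definition forest :: "('v, 'e) ugraph \<Rightarrow> bool" where
  "forest G \<longleftrightarrow> finite_graph G \<and> \<not> (\<exists>u p. cycle G u p)"

definition connects :: "('v, 'e) ugraph \<Rightarrow> 'v set \<Rightarrow> bool" where
  "connects G U \<longleftrightarrow> (\<forall>u \<in> U. \<forall>v \<in> U. \<exists>p. walk G u p v)"

text \<open>The graph without vertices counts as connected.\<close>

definition connected :: "('v, 'e) ugraph \<Rightarrow> bool" where
  "connected G \<longleftrightarrow> finite_graph G \<and> connects G (verts G)"

text \<open>A subgraph that is a spanning forest need not contain all vertices of the larger graph.\<close>

definition spanning_forest :: "('v, 'e) ugraph \<Rightarrow> ('v, 'e) ugraph \<Rightarrow> bool" where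
  "spanning_forest F G \<longleftrightarrow> subgraph F G \<and> forest F"

definition spanning_tree :: "('v, 'e) ugraph \<Rightarrow> ('v, 'e) ugraph \<Rightarrow> bool" where
  "spanning_tree T G \<longleftrightarrow> subgraph T G \<and> connects T (verts G) \<and> forest T"

lemma walk_start_in_verts: "walk G u p v \<Longrightarrow> u \<in> verts G"
  by (cases p) auto

lemma spanning_tree_verts: "spanning_tree T G \<Longrightarrow> verts T = verts G"
  unfolding spanning_tree_def subgraph_def connects_def
  by (blast dest: walk_start_in_verts)

lemma spanning_tree_connected: "spanning_tree T G \<Longrightarrow> connected T"
  using spanning_tree_verts[of T G]
  by (auto simp: spanning_tree_def connected_def forest_def)

end

theory Submission
  imports Defs
begin

text \<open>
  Among the edge sets of \<open>G\<close> that contain the edges of \<open>F\<close> and form an acyclic graph on all the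
  vertices of \<open>G\<close>, take one that is maximal under inclusion; one exists because \<open>G\<close> is finite and
  the edges of \<open>F\<close> are a candidate (\<open>forest_spanning_subgraph\<close>). The resulting forest \<open>T\<close>
  connects the endpoints of every edge \<open>e\<close> of \<open>G\<close>: either \<open>e\<close> already belongs to \<open>T\<close>, or by
  maximality \<open>T\<close> together with \<open>e\<close> has a cycle, which must use \<open>e\<close>, and the rest of this
  cycle joins the endpoints of \<open>e\<close> inside \<open>T\<close> (\<open>endpoints_joined_if_edge_closes_cycle\<close>).
  Replacing each edge of a walk in \<open>G\<close> by a walk in \<open>T\<close> shows that \<open>T\<close> inherits the
  connectedness of \<open>G\<close>.
\<close>

lemma endpoints_in_verts:
  assumes "finite_graph G" "e \<in> edges G" "ends G e = {x, y}"
  shows "x \<in> verts G" "y \<in> verts G"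
proof -
  obtain a b where "a \<in> verts G" "b \<in> verts G" "{x, y} = {a, b}"
    using assms unfolding finite_graph_def by metis
  then show "x \<in> verts G" "y \<in> verts G" by (auto simp: doubleton_eq_iff)
qed

lemma finite_graph_restrict_edges:
  assumes "finite_graph G" and "A \<subseteq> edges G"
  shows "finite_graph (G\<lparr>edges := A\<rparr>)"
  using assms finite_subset unfolding finite_graph_def by auto

lemma walk_append:
  "walk G u (p @ q) v \<longleftrightarrow> (\<exists>w. walk G u p w \<and> walk G w q v)"
  by (induction p arbitrary: u) (auto dest: walk_start_in_verts)

lemma walk_reversible: "walk G u p v \<Longrightarrow> \<exists>q. walk G v q u"
proof (induction G u p v rule: walk.induct)
  case (1 G u v)
  then have "walk G v [] u" by auto
  then show ?case ..
next
  case (2 G u e w p v)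
  then obtain q where "walk G v q w" by auto
  moreover have "walk G w [(e, u)] u"
    using 2 by (auto simp: insert_commute dest: walk_start_in_verts)
  ultimately show ?case using walk_append by metis
qed

lemma walk_replace_edges:
  assumes "walk G u p v" and "verts G \<subseteq> verts T"
    and "\<And>e x y. e \<in> edges G \<Longrightarrow> ends G e = {x, y} \<Longrightarrow> \<exists>q. walk T x q y"
  shows "\<exists>q. walk T u q v"
  using assms
proof (induction G u p v rule: walk.induct)
  case (1 G u v)
  then have "walk T u [] v" by auto
  then show ?case ..
next
  case (2 G u e w p v)
  then obtain q r where "walk T w q v" "walk T u r w" by (metis walk.simps(2))
  then show ?case using walk_append by metis
qed

lemma walk_avoiding_edge:
  assumes "walk (G\<lparr>edges := insert e A\<rparr>) u p v" and "e \<notin> fst ` set p"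
  shows "walk (G\<lparr>edges := A\<rparr>) u p v"
  using assms by (induction p arbitrary: u) auto

text \<open>
  A cycle traverses the new edge exactly once. What precedes and what follows this step are therefore
  walks in the old graph, and swapping them around the start vertex of the cycle yields a
  single walk between the endpoints of the edge.
\<close>

lemma endpoints_joined_if_edge_closes_cycle:
  assumes acyclic: "\<nexists>u p. cycle (G\<lparr>edges := A\<rparr>) u p"
    and cyc: "cycle (G\<lparr>edges := insert e A\<rparr>) u p"
    and e: "ends G e = {x, y}"
  shows "\<exists>q. walk (G\<lparr>edges := A\<rparr>) x q y"
proof -
  let ?T = "G\<lparr>edges := A\<rparr>" and ?T' = "G\<lparr>edges := insert e A\<rparr>"
  have "e \<in> fst ` set p"
    using acyclic cyc walk_avoiding_edge unfolding cycle_def by metis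
  then obtain b p1 p2 where p: "p = p1 @ (e, b) # p2"
    by (metis imageE prod.collapse split_list)
  with cyc obtain a where "walk ?T' u p1 a" "ends G e = {a, b}" "walk ?T' b p2 u"
    unfolding cycle_def by (auto simp: walk_append)
  moreover have "e \<notin> fst ` set p1" "e \<notin> fst ` set p2"
    using cyc p by (auto simp: cycle_def)
  ultimately have ba: "walk ?T b (p2 @ p1) a"
    by (metis walk_append walk_avoiding_edge)
  have "(x = a \<and> y = b) \<or> (x = b \<and> y = a)"
    using e \<open>ends G e = {a, b}\<close> by (auto simp: doubleton_eq_iff)
  then show ?thesis using ba walk_reversible by metis
qed

text \<open>
  Adding the vertices of \<open>G\<close> to a subforest creates no cycle: a cycle has a first edge, so it starts at
  a vertex of the subforest and never leaves it.
\<close>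

lemma forest_spanning_subgraph:
  assumes sub: "subgraph F G" and "forest F"
  shows "forest (G\<lparr>edges := edges F\<rparr>)"
proof -
  let ?H = "G\<lparr>edges := edges F\<rparr>"
  have ends_eq: "ends F e = ends G e" if "e \<in> edges F" for e
    using sub that by (simp add: subgraph_def)
  have ends_in: "x \<in> verts F" "y \<in> verts F" if "e \<in> edges F" "ends G e = {x, y}" for e x y
    using endpoints_in_verts[of F e x y] sub that ends_eq by (auto simp: subgraph_def)
  have walk_in: "walk F u p v" if "walk ?H u p v" "u \<in> verts F" for u p v
    using that
  proof (induction p arbitrary: u)
    case Nil
    then show ?case by simp
  next
    case (Cons s p)
    obtain e w where s: "s = (e, w)" by (cases s)
    then have e: "e \<in> edges F" "ends G e = {u, w}" and p: "walk ?H w p v"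
      using Cons.prems(1) by auto
    have "walk F w p v" using p ends_in(2)[OF e] by (rule Cons.IH)
    then show ?case using s e ends_eq[OF e(1)] Cons.prems(2) by simp
  qed
  have "cycle F u p" if "cycle ?H u p" for u p
  proof -
    have walk: "walk ?H u p u" and "p \<noteq> []" using that by (auto simp: cycle_def)
    then obtain e w q where "p = (e, w) # q" by (cases p) auto
    then have "e \<in> edges F" "ends G e = {u, w}" using walk by auto
    then have "u \<in> verts F" by (rule ends_in(1))
    with walk have "walk F u p u" by (rule walk_in)
    then show ?thesis using that by (simp add: cycle_def)
  qed
  moreover have "finite_graph ?H"
    using sub by (simp add: subgraph_def finite_graph_restrict_edges)
  ultimately show ?thesis using \<open>forest F\<close> by (auto simp: forest_def)
qed

theorem theorem1:
  fixes G F :: "('v, 'e) ugraph"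
  assumes "connected G"
    and "spanning_forest F G"
  shows "\<exists>T. spanning_tree T G \<and> subgraph F T"
proof -
  have fin: "finite_graph G" and conn: "connects G (verts G)"
    using assms(1) by (auto simp: connected_def)
  have F: "subgraph F G" "forest F"
    using assms(2) by (auto simp: spanning_forest_def)
  define C where "C = {A. A \<subseteq> edges G \<and> forest (G\<lparr>edges := A\<rparr>)}"
  have "finite C" using fin by (auto simp: C_def finite_graph_def)
  moreover have "edges F \<in> C"
    using F forest_spanning_subgraph by (auto simp: C_def subgraph_def)
  ultimately obtain A where A: "A \<in> C" "edges F \<subseteq> A"
    and maximal: "\<forall>B\<in>C. A \<subseteq> B \<longrightarrow> A = B"
    by (metis finite_has_maximal2)
  let ?T = "G\<lparr>edges := A\<rparr>"
  have forest: "forest ?T" and AG: "A \<subseteq> edges G" using A by (auto simp: C_def)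
  have joined: "\<exists>q. walk ?T x q y" if e: "e \<in> edges G" "ends G e = {x, y}" for e x y
  proof (cases "e \<in> A")
    case True
    have "x \<in> verts G" "y \<in> verts G"
      using fin e by (rule endpoints_in_verts)+
    then have "walk ?T x [(e, y)] y" using e True by simp
    then show ?thesis ..
  next
    case False
    then have "\<not> forest (G\<lparr>edges := insert e A\<rparr>)"
      using maximal[THEN bspec, of "insert e A"] AG e by (auto simp: C_def)
    moreover have "finite_graph (G\<lparr>edges := insert e A\<rparr>)"
      using fin AG e by (simp add: finite_graph_restrict_edges)
    ultimately obtain u p where "cycle (G\<lparr>edges := insert e A\<rparr>) u p"
      by (auto simp: forest_def)
    then show ?thesis
      using endpoints_joined_if_edge_closes_cycle forest e(2) unfolding forest_def by metis
  qed
  have "connects ?T (verts G)"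
    unfolding connects_def
  proof (intro ballI)
    fix u v assume "u \<in> verts G" "v \<in> verts G"
    then obtain p where "walk G u p v" using conn by (auto simp: connects_def)
    then show "\<exists>q. walk ?T u q v" by (rule walk_replace_edges) (use joined in auto)
  qed
  moreover have "subgraph ?T G"
    using fin forest AG by (auto simp: subgraph_def forest_def)
  moreover have "subgraph F ?T"
    using F forest A by (auto simp: subgraph_def forest_def)
  ultimately show ?thesis
    using forest unfolding spanning_tree_def by blast
qed

end
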